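(* Let $G$ be a CUH graph and let $H\in O(G)$ be a graph that is not monochromatic. For each color $c\in\{\text{red},\text{blue}\}$ let $H_c$ be the subgraph of $H$ induced by the vertices of color $c$. Then for each color $c$ one of the following holds: (i) $H_c\cong K_n$ for some $n\ge3$ and any two vertices of $H_c$ are twins in $H$; (ii) $H_c\cong K_2$; (iii) $H_c\cong\overline{K}_n$ for some $n\in\mathbb{N}_{\ge1}$.
   Context: All graphs are simple. A 2-colored graph is a graph with a map $\chi\colon V(G)\to\{\text{red},\text{blue}\}$; $R,B$ are the red and blue vertex sets; induced subgraphs inherit colors; isomorphisms are color-preserving. $G$ is ultrahomogeneous if every isomorphism between finite induced subgraphs extends to an automorphism. A CUH graph is a countably infinite ultrahomogeneous 2-colored graph in which $G[R]$ and $G[B]$ are disjoint unions of cliques. A finite 2-colored graph is realized in $G$ if isomorphic to an induced subgraph of $G$, omitted otherwise, and minimally omitted if omitted while all proper induced subgraphs are realized; $O(G)$ is the set of minimally omitted graphs. Monochromatic means having only one color. Two vertices $v,v'$ of a 2-colored graph $H$ are twins if they have the same color and $N_H(v)\setminus\{v'\}=N_H(v')\setminus\{v\}$. *)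

theory Defs
  imports Main "HOL-Library.Countable_Set" "HOL-Library.Disjoint_Sets"
begin

record 'a graph =
  verts :: "'a set"
  adj :: "'a \<Rightarrow> 'a \<Rightarrow> bool"

datatype color = Red | Blue

text \<open>Only the colors of the vertices in \<open>verts G\<close> are meaningful; no notion below looks at
  the value of \<open>col G\<close> elsewhere.\<close>

record 'a colored_graph = "'a graph" +
  col :: "'a \<Rightarrow> color"

definition simple_graph :: "('a, 'x) graph_scheme \<Rightarrow> bool" where
  "simple_graph G \<longleftrightarrow>
     (\<forall>u v. adj G u v \<longrightarrow> u \<in> verts G \<and> v \<in> verts G) \<and>
     (\<forall>u v. adj G u v \<longrightarrow> adj G v u) \<and>
     (\<forall>v. \<not> adj G v v)"

text \<open>Being a record update, this keeps the coloring of a colored graph. It is used for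
  \<open>S \<subseteq> verts G\<close> only.\<close>

definition induced :: "('a, 'x) graph_scheme \<Rightarrow> 'a set \<Rightarrow> ('a, 'x) graph_scheme" where
  "induced G S = G\<lparr>verts := S, adj := (\<lambda>u v. u \<in> S \<and> v \<in> S \<and> adj G u v)\<rparr>"

definition graph_iso ::
  "('a \<Rightarrow> 'b) \<Rightarrow> ('a, 'x) graph_scheme \<Rightarrow> ('b, 'y) graph_scheme \<Rightarrow> bool" where
  "graph_iso f G H \<longleftrightarrow>
     bij_betw f (verts G) (verts H) \<and>
     (\<forall>u\<in>verts G. \<forall>v\<in>verts G. adj H (f u) (f v) \<longleftrightarrow> adj G u v)"

definition isomorphic_graphs :: "('a, 'x) graph_scheme \<Rightarrow> ('b, 'y) graph_scheme \<Rightarrow> bool" where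
  "isomorphic_graphs G H \<longleftrightarrow> (\<exists>f. graph_iso f G H)"

definition complete_graph :: "nat \<Rightarrow> nat graph" where
  "complete_graph n = \<lparr>verts = {..<n}, adj = (\<lambda>u v. u < n \<and> v < n \<and> u \<noteq> v)\<rparr>"

definition edgeless_graph :: "nat \<Rightarrow> nat graph" where
  "edgeless_graph n = \<lparr>verts = {..<n}, adj = (\<lambda>u v. False)\<rparr>"

definition disjoint_union_of_cliques :: "('a, 'x) graph_scheme \<Rightarrow> bool" where
  "disjoint_union_of_cliques G \<longleftrightarrow>
     (\<exists>P. partition_on (verts G) P \<and>
        (\<forall>u\<in>verts G. \<forall>v\<in>verts G. adj G u v \<longleftrightarrow> u \<noteq> v \<and> (\<exists>C\<in>P. u \<in> C \<and> v \<in> C)))"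

definition colored_iso ::
  "('a \<Rightarrow> 'b) \<Rightarrow> 'a colored_graph \<Rightarrow> 'b colored_graph \<Rightarrow> bool" where
  "colored_iso f G H \<longleftrightarrow> graph_iso f G H \<and> (\<forall>v\<in>verts G. col H (f v) = col G v)"

definition color_class :: "'a colored_graph \<Rightarrow> color \<Rightarrow> 'a set" where
  "color_class G c = {v \<in> verts G. col G v = c}"

definition color_subgraph :: "'a colored_graph \<Rightarrow> color \<Rightarrow> 'a colored_graph" where
  "color_subgraph G c = induced G (color_class G c)"

definition monochromatic :: "'a colored_graph \<Rightarrow> bool" where
  "monochromatic G \<longleftrightarrow> (\<exists>c. \<forall>v\<in>verts G. col G v = c)"

definition ultrahomogeneous :: "'a colored_graph \<Rightarrow> bool" where
  "ultrahomogeneous G \<longleftrightarrow>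
     (\<forall>S T f. S \<subseteq> verts G \<and> T \<subseteq> verts G \<and> finite S \<and> finite T \<and>
        colored_iso f (induced G S) (induced G T) \<longrightarrow>
        (\<exists>g. colored_iso g G G \<and> (\<forall>v\<in>S. g v = f v)))"

definition CUH_graph :: "'a colored_graph \<Rightarrow> bool" where
  "CUH_graph G \<longleftrightarrow>
     simple_graph G \<and> countable (verts G) \<and> infinite (verts G) \<and> ultrahomogeneous G \<and>
     disjoint_union_of_cliques (color_subgraph G Red) \<and>
     disjoint_union_of_cliques (color_subgraph G Blue)"

definition realized :: "'b colored_graph \<Rightarrow> 'a colored_graph \<Rightarrow> bool" where
  "realized H G \<longleftrightarrow> (\<exists>S \<subseteq> verts G. \<exists>f. colored_iso f H (induced G S))"

text \<open>The vertex type \<open>'b\<close> of the omitted graphs is independent of that of \<open>G\<close>.\<close>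

definition minimally_omitted :: "'a colored_graph \<Rightarrow> 'b colored_graph set" where
  "minimally_omitted G =
     {H. simple_graph H \<and> finite (verts H) \<and> \<not> realized H G \<and>
         (\<forall>S. S \<subset> verts H \<longrightarrow> realized (induced H S) G)}"

definition neighborhood :: "('a, 'x) graph_scheme \<Rightarrow> 'a \<Rightarrow> 'a set" where
  "neighborhood G v = {u \<in> verts G. adj G v u}"

definition twins :: "'a colored_graph \<Rightarrow> 'a \<Rightarrow> 'a \<Rightarrow> bool" where
  "twins H v v' \<longleftrightarrow>
     v \<in> verts H \<and> v' \<in> verts H \<and> col H v = col H v' \<and>
     neighborhood H v - {v'} = neighborhood H v' - {v}"

end

theory Submission
  imports Defs
begin

text \<open>Let \<open>u \<noteq> v\<close> be vertices of \<open>H \<in> O(G)\<close>. Ultrahomogeneity lets us amalgamate copies of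
  \<open>H - u\<close> and \<open>H - v\<close> in \<open>G\<close> over \<open>H - {u, v}\<close>. Since \<open>H\<close> is omitted, the amalgam either
  identifies \<open>u\<close> with \<open>v\<close> or has the wrong adjacency between them. If \<open>u\<close> and \<open>v\<close> have the same
  color and \<open>w\<close> is a third vertex of that color, adjacent to at least one of them, then
  transitivity of adjacency in the color classes of \<open>G\<close> forces the adjacency of \<open>u\<close> and \<open>v\<close>.
  Hence no such \<open>w\<close> exists when \<open>u\<close> and \<open>v\<close> are non-adjacent, and when they are adjacent they
  must be identified, which makes them twins.\<close>

section \<open>Colored embeddings of induced subgraphs\<close>

text \<open>Keeping \<open>H\<close> and \<open>S\<close> as separate arguments lets one total map
  \<open>f\<close> be restricted to, and tested on, several vertex sets of the same graph. Its
  values outside \<open>S\<close> are arbitrary.\<close>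

definition colored_embedding ::
  "('b \<Rightarrow> 'a) \<Rightarrow> 'b colored_graph \<Rightarrow> 'b set \<Rightarrow> 'a colored_graph \<Rightarrow> bool" where
  "colored_embedding f H S G \<longleftrightarrow>
     inj_on f S \<and> f ` S \<subseteq> verts G \<and>
     (\<forall>x\<in>S. \<forall>y\<in>S. adj G (f x) (f y) \<longleftrightarrow> adj H x y) \<and>
     (\<forall>x\<in>S. col G (f x) = col H x)"

lemma induced_simps [simp]:
  "verts (induced G S) = S"
  "adj (induced G S) x y \<longleftrightarrow> x \<in> S \<and> y \<in> S \<and> adj G x y"
  "col (induced H S) = col H"
  by (simp_all add: induced_def)

lemma realized_induced_iff:
  "realized (induced H S) G \<longleftrightarrow> (\<exists>f. colored_embedding f H S G)"
proof
  assume "realized (induced H S) G"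
  then obtain T f where "T \<subseteq> verts G" "colored_iso f (induced H S) (induced G T)"
    unfolding realized_def by blast
  then have "colored_embedding f H S G"
    by (auto simp: colored_iso_def graph_iso_def bij_betw_def colored_embedding_def)
  then show "\<exists>f. colored_embedding f H S G"
    by blast
next
  assume "\<exists>f. colored_embedding f H S G"
  then obtain f where f: "colored_embedding f H S G" ..
  then have "colored_iso f (induced H S) (induced G (f ` S))"
    by (simp add: colored_iso_def graph_iso_def bij_betw_def colored_embedding_def)
  then show "realized (induced H S) G"
    using f unfolding realized_def colored_embedding_def by blast
qed

text \<open>In a simple graph \<open>adj\<close> is false outside \<open>verts\<close>, so the
  restriction returns the very same record and not just an isomorphic one.\<close>

lemma induced_verts:
  assumes "simple_graph (G :: 'a colored_graph)"
  shows "induced G (verts G) = G"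
  using assms by (cases G) (auto simp: induced_def simple_graph_def fun_eq_iff)

lemma realized_iff:
  assumes "simple_graph H"
  shows "realized H G \<longleftrightarrow> (\<exists>f. colored_embedding f H (verts H) G)"
  using realized_induced_iff[of H "verts H" G] induced_verts[OF assms] by simp

lemma colored_embedding_subset:
  "colored_embedding f H S G \<Longrightarrow> T \<subseteq> S \<Longrightarrow> colored_embedding f H T G"
  unfolding colored_embedding_def by (blast intro: inj_on_subset)

lemma colored_embedding_compose_iso:
  assumes f: "colored_embedding f H S G" and g: "colored_iso g G G'"
  shows "colored_embedding (g \<circ> f) H S G'"
proof -
  have "inj_on g (verts G)" "g ` verts G = verts G'"
    using g by (auto simp: colored_iso_def graph_iso_def bij_betw_def)
  moreover have "f ` S \<subseteq> verts G" "inj_on f S"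
    using f by (auto simp: colored_embedding_def)
  ultimately have "inj_on (g \<circ> f) S" "(g \<circ> f) ` S \<subseteq> verts G'"
    by (auto intro: comp_inj_on inj_on_subset)
  moreover have "f x \<in> verts G" if "x \<in> S" for x
    using \<open>f ` S \<subseteq> verts G\<close> that by auto
  ultimately show ?thesis
    using f g by (auto simp: colored_embedding_def colored_iso_def graph_iso_def)
qed

lemma colored_embedding_cong:
  assumes "\<And>x. x \<in> S \<Longrightarrow> f x = g x"
  shows "colored_embedding f H S G \<longleftrightarrow> colored_embedding g H S G"
proof -
  have "inj_on f S = inj_on g S" "f ` S = g ` S"
    using assms inj_on_cong[of S f g] by auto
  then show ?thesis
    using assms by (simp add: colored_embedding_def)
qed

section \<open>Amalgamation in an ultrahomogeneous graph\<close>

text \<open>Going back along \<open>f2\<close> and forward along \<open>f1\<close> is an isomorphism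
  between the two finite copies of \<open>induced H S\<close>; ultrahomogeneity extends it to an
  automorphism.\<close>

lemma ultrahomogeneous_amalgamation:
  assumes G: "ultrahomogeneous G" and fin: "finite S"
    and f1: "colored_embedding f1 H S G" and f2: "colored_embedding f2 H S G"
  obtains g where "colored_iso g G G" "\<And>x. x \<in> S \<Longrightarrow> g (f2 x) = f1 x"
proof -
  define h where "h = f1 \<circ> inv_into S f2"
  have inj: "inj_on f1 S" "inj_on f2 S"
    using f1 f2 by (auto simp: colored_embedding_def)
  have h: "h (f2 x) = f1 x" if "x \<in> S" for x
    using that inj by (simp add: h_def)
  have "bij_betw h (f2 ` S) (f1 ` S)"
    unfolding h_def
    by (intro bij_betw_trans[of _ _ S] inj_on_imp_bij_betw bij_betw_inv_into inj)
  then have "colored_iso h (induced G (f2 ` S)) (induced G (f1 ` S))"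
    using f1 f2 h by (auto simp: colored_iso_def graph_iso_def colored_embedding_def)
  moreover have "f2 ` S \<subseteq> verts G" "f1 ` S \<subseteq> verts G"
    using f1 f2 by (auto simp: colored_embedding_def)
  ultimately have "\<exists>g. colored_iso g G G \<and> (\<forall>y\<in>f2 ` S. g y = h y)"
    using G[unfolded ultrahomogeneous_def, rule_format, of "f2 ` S" "f1 ` S" h] fin by simp
  then obtain g where "colored_iso g G G" "\<forall>y\<in>f2 ` S. g y = h y"
    by blast
  then show thesis
    using h by (intro that[of g]) auto
qed

text \<open>The amalgam is recorded as a single map \<open>f\<close> on \<open>verts H\<close>. The
  only pair of vertices contained in neither \<open>verts H - {u}\<close> nor
  \<open>verts H - {v}\<close> is \<open>u\<close>, \<open>v\<close>, so the failure of
  \<open>f\<close> to embed \<open>H\<close> must show there.\<close>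

lemma minimally_omitted_amalgam:
  assumes G: "simple_graph G" "ultrahomogeneous G" and H: "H \<in> minimally_omitted G"
    and u: "u \<in> verts H" and v: "v \<in> verts H" and uv: "u \<noteq> v"
  obtains f where "colored_embedding f H (verts H - {u}) G"
    "colored_embedding f H (verts H - {v}) G"
    "f u = f v \<or> adj G (f u) (f v) \<noteq> adj H u v"
proof -
  have sH: "simple_graph H" and fin: "finite (verts H)" and om: "\<not> realized H G"
    and min: "\<And>S. S \<subset> verts H \<Longrightarrow> \<exists>f. colored_embedding f H S G"
    using H by (auto simp: minimally_omitted_def realized_induced_iff)
  obtain f1 where f1: "colored_embedding f1 H (verts H - {u}) G"
    using min[of "verts H - {u}"] u by auto
  obtain f2 where f2: "colored_embedding f2 H (verts H - {v}) G"
    using min[of "verts H - {v}"] v by auto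
  obtain g where g: "colored_iso g G G"
    and g_eq: "\<And>x. x \<in> verts H - {u, v} \<Longrightarrow> g (f2 x) = f1 x"
    using ultrahomogeneous_amalgamation[of G "verts H - {u, v}" f1 H f2] G(2) fin
      colored_embedding_subset[OF f1, of "verts H - {u, v}"]
      colored_embedding_subset[OF f2, of "verts H - {u, v}"]
    by blast
  \<comment> \<open>Since \<open>f1\<close> and \<open>g \<circ> f2\<close> agree off
    \<open>u\<close> and \<open>v\<close>, this map is \<open>f1\<close> on
    \<open>verts H - {u}\<close> and \<open>g \<circ> f2\<close> on
    \<open>verts H - {v}\<close>.\<close>
  define f where "f = f1(u := g (f2 u))"
  have fu: "colored_embedding f H (verts H - {u}) G"
    using f1 colored_embedding_cong[of "verts H - {u}" f f1] by (simp add: f_def)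
  have "f x = (g \<circ> f2) x" if "x \<in> verts H - {v}" for x
    using that g_eq by (auto simp: f_def)
  then have fv: "colored_embedding f H (verts H - {v}) G"
    using colored_embedding_compose_iso[OF f2 g] colored_embedding_cong by blast
  have False if "f u \<noteq> f v" and e: "adj G (f u) (f v) = adj H u v"
  proof -
    have fx: "f x \<in> verts G \<and> col G (f x) = col H x" if "x \<in> verts H" for x
      using that fu fv uv unfolding colored_embedding_def by (cases "x = u") auto
    have symG: "adj G x y = adj G y x" and symH: "adj H a b = adj H b a" for x y a b
      using G sH by (auto simp: simple_graph_def)
    have both: "(f x = f y \<longrightarrow> x = y) \<and> (adj G (f x) (f y) \<longleftrightarrow> adj H x y)"
      if "x \<in> verts H" "y \<in> verts H" for x y
    proof -
      \<comment> \<open>A pair that avoids \<open>u\<close> or avoids \<open>v\<close> lies in the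
        domain of one of the two embeddings; the pair \<open>u\<close>, \<open>v\<close> itself is
        settled by the assumptions being refuted.\<close>
      consider "x \<noteq> u" "y \<noteq> u" | "x \<noteq> v" "y \<noteq> v" | "x = u" "y = v" | "x = v" "y = u"
        using uv by blast
      then show ?thesis
      proof cases
        case 1
        then show ?thesis using that fu by (auto simp: colored_embedding_def inj_on_def)
      next
        case 2
        then show ?thesis using that fv by (auto simp: colored_embedding_def inj_on_def)
      next
        case 3
        then show ?thesis using \<open>f u \<noteq> f v\<close> e by simp
      next
        case 4
        then show ?thesis using \<open>f u \<noteq> f v\<close> e symG symH by metis
      qed
    qed
    have "colored_embedding f H (verts H) G"
      using fx both by (auto simp: colored_embedding_def inj_on_def)
    then show False
      using om realized_iff[OF sH] by blast
  qed
  then show thesis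
    using that[OF fu fv] by blast
qed

section \<open>Transitivity of adjacency within a color\<close>

text \<open>The cliques partition the color class, so the clique of \<open>x\<close> and
  \<open>y\<close> and the clique of \<open>y\<close> and \<open>z\<close> share \<open>y\<close>
  and coincide.\<close>

lemma CUH_adj_trans:
  assumes G: "CUH_graph G" and mem: "x \<in> verts G" "y \<in> verts G" "z \<in> verts G"
    and col: "col G x = col G y" "col G z = col G y"
    and adj: "adj G x y" "adj G y z" and "x \<noteq> z"
  shows "adj G x z"
proof -
  define c where "c = col G y"
  have "disjoint_union_of_cliques (color_subgraph G c)"
    using G by (cases c) (auto simp: CUH_graph_def)
  then obtain P where P: "partition_on (color_class G c) P"
    and e: "\<And>a b. a \<in> color_class G c \<Longrightarrow> b \<in> color_class G c \<Longrightarrow>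
      adj G a b \<longleftrightarrow> a \<noteq> b \<and> (\<exists>C\<in>P. a \<in> C \<and> b \<in> C)"
    unfolding disjoint_union_of_cliques_def by (auto simp: color_subgraph_def)
  have m: "x \<in> color_class G c" "y \<in> color_class G c" "z \<in> color_class G c"
    using mem col by (auto simp: color_class_def c_def)
  obtain C D where CD: "C \<in> P" "D \<in> P" "x \<in> C" "y \<in> C" "y \<in> D" "z \<in> D"
    using e[OF m(1,2)] e[OF m(2,3)] adj by auto
  then have "C = D"
    using P by (auto simp: partition_on_def disjoint_def)
  then show ?thesis
    using e[OF m(1,3)] CD \<open>x \<noteq> z\<close> by auto
qed

section \<open>Recognizing complete and edgeless graphs\<close>

lemma isomorphic_complete_graphI:
  assumes fin: "finite (verts G)"
    and "\<And>u v. u \<in> verts G \<Longrightarrow> v \<in> verts G \<Longrightarrow> adj G u v \<longleftrightarrow> u \<noteq> v"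
  shows "isomorphic_graphs G (complete_graph (card (verts G)))"
proof -
  obtain f where f: "bij_betw f (verts G) {..<card (verts G)}"
    using ex_bij_betw_finite_nat[OF fin] by (auto simp: atLeast0LessThan)
  then have "f u < card (verts G)" if "u \<in> verts G" for u
    using that by (auto simp: bij_betw_def)
  moreover have "f u = f v \<longleftrightarrow> u = v" if "u \<in> verts G" "v \<in> verts G" for u v
    using f that by (auto simp: bij_betw_def inj_on_def)
  ultimately have "graph_iso f G (complete_graph (card (verts G)))"
    using f assms(2) by (simp add: graph_iso_def complete_graph_def)
  then show ?thesis
    unfolding isomorphic_graphs_def by blast
qed

lemma isomorphic_edgeless_graphI:
  assumes fin: "finite (verts G)"
    and "\<And>u v. u \<in> verts G \<Longrightarrow> v \<in> verts G \<Longrightarrow> \<not> adj G u v"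
  shows "isomorphic_graphs G (edgeless_graph (card (verts G)))"
proof -
  obtain f where "bij_betw f (verts G) {..<card (verts G)}"
    using ex_bij_betw_finite_nat[OF fin] by (auto simp: atLeast0LessThan)
  then have "graph_iso f G (edgeless_graph (card (verts G)))"
    using assms(2) by (simp add: graph_iso_def edgeless_graph_def)
  then show ?thesis
    unfolding isomorphic_graphs_def by blast
qed

section \<open>Color classes of a minimally omitted graph\<close>

text \<open>Properness makes the subgraph on each color class realized, by minimality; non-emptiness
  gives the bound \<open>n \<ge> 1\<close> in the edgeless case.\<close>

lemma not_monochromatic_color_classes:
  assumes "\<not> monochromatic H"
  shows "color_class H c \<noteq> {}" "color_class H c \<subset> verts H"
proof -
  obtain x where x: "x \<in> verts H" "col H x \<noteq> c"
    using assms unfolding monochromatic_def by blast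
  obtain d :: color where d: "d \<noteq> c"
    by (cases c) auto
  obtain y where y: "y \<in> verts H" "col H y \<noteq> d"
    using assms unfolding monochromatic_def by blast
  then have "col H y = c"
    using d by (cases c; cases d; cases "col H y") auto
  then show "color_class H c \<noteq> {}" "color_class H c \<subset> verts H"
    using x y by (auto simp: color_class_def)
qed

text \<open>Otherwise \<open>w\<close> would keep the images of \<open>u\<close> and
  \<open>v\<close> distinct and non-adjacent in the amalgam. The asymmetric form, with only
  \<open>u\<close> assumed to have a neighbor, allows one edge to spread over the whole
  class.\<close>

lemma minimally_omitted_color_class_adj:
  assumes G: "CUH_graph G" and H: "H \<in> minimally_omitted G" and nm: "\<not> monochromatic H"
    and mem: "u \<in> color_class H c" "v \<in> color_class H c" "w \<in> color_class H c"
    and uw: "adj H u w" and uv: "u \<noteq> v"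
  shows "adj H u v"
proof (rule ccontr)
  assume nadj: "\<not> adj H u v"
  have sG: "simple_graph G" and uG: "ultrahomogeneous G"
    using G by (auto simp: CUH_graph_def)
  have sH: "simple_graph H"
    using H by (simp add: minimally_omitted_def)
  have symG: "\<And>x y. adj G x y \<Longrightarrow> adj G y x"
    using sG by (auto simp: simple_graph_def)
  have cc: "col H u = c" "col H v = c" "col H w = c"
    and vs: "u \<in> verts H" "v \<in> verts H" "w \<in> verts H"
    using mem by (auto simp: color_class_def)
  have ne: "u \<noteq> w" "v \<noteq> w"
    using sH uw nadj by (auto simp: simple_graph_def)
  \<comment> \<open>A copy of the color class in \<open>G\<close> transfers transitivity back to
    \<open>H\<close>, so that \<open>w\<close>, being adjacent to \<open>u\<close>, cannot be
    adjacent to \<open>v\<close>.\<close>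
  have "realized (induced H (color_class H c)) G"
    using H not_monochromatic_color_classes(2)[OF nm] by (simp add: minimally_omitted_def)
  then obtain h where h: "colored_embedding h H (color_class H c) G"
    unfolding realized_induced_iff ..
  have vw: "\<not> adj H w v"
  proof
    assume "adj H w v"
    then have "adj G (h u) (h w)" "adj G (h w) (h v)" "h u \<noteq> h v"
      "h u \<in> verts G" "h v \<in> verts G" "h w \<in> verts G"
      "col G (h u) = col G (h w)" "col G (h v) = col G (h w)"
      using h uw mem uv cc by (auto simp: colored_embedding_def inj_on_def)
    then have "adj G (h u) (h v)"
      using CUH_adj_trans[OF G, of "h u" "h w" "h v"] by simp
    then show False
      using h mem nadj by (auto simp: colored_embedding_def)
  qed
  obtain f where fu: "colored_embedding f H (verts H - {u}) G"
    and fv: "colored_embedding f H (verts H - {v}) G"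
    and f: "f u = f v \<or> adj G (f u) (f v) \<noteq> adj H u v"
    using minimally_omitted_amalgam[OF sG uG H vs(1,2) uv] by blast
  have f_in: "f u \<in> verts G" "f v \<in> verts G" "f w \<in> verts G"
    "col G (f u) = c" "col G (f v) = c" "col G (f w) = c"
    using fu fv vs ne uv cc by (auto simp: colored_embedding_def)
  have a: "adj G (f u) (f w)"
    using fv vs ne uv uw by (simp add: colored_embedding_def)
  have na: "\<not> adj G (f w) (f v)"
    using fu vs ne uv vw by (simp add: colored_embedding_def)
  have "f w \<noteq> f v"
    using fu vs ne uv unfolding colored_embedding_def by (metis Diff_iff inj_onD singletonD)
  \<comment> \<open>The vertex \<open>f w\<close> is adjacent to \<open>f u\<close> but not to
    \<open>f v\<close>. With identification excluded, the amalgam must have an edge between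
    \<open>f u\<close> and \<open>f v\<close>.\<close>
  have "f u \<noteq> f v"
    using symG[OF a] na by auto
  then have "adj G (f u) (f v)"
    using f nadj by blast
  then have "adj G (f w) (f v)"
    using CUH_adj_trans[OF G, of "f w" "f u" "f v"] f_in symG[OF a] \<open>f w \<noteq> f v\<close> by simp
  then show False
    using na by simp
qed

text \<open>The common neighbor \<open>w\<close> makes \<open>f u\<close> and \<open>f v\<close>
  adjacent unless they are equal, so the amalgam has to identify them. A class with two vertices
  offers no such \<open>w\<close>, whence the separate case of \<open>K_2\<close> without a twin
  condition.\<close>

lemma minimally_omitted_triangle_twins:
  assumes G: "CUH_graph G" and H: "H \<in> minimally_omitted G"
    and mem: "u \<in> color_class H c" "v \<in> color_class H c" "w \<in> color_class H c"
    and adj: "adj H u v" "adj H u w" "adj H v w"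
  shows "twins H u v"
proof -
  have sG: "simple_graph G" and uG: "ultrahomogeneous G"
    using G by (auto simp: CUH_graph_def)
  have sH: "simple_graph H"
    using H by (simp add: minimally_omitted_def)
  have symG: "\<And>x y. adj G x y \<Longrightarrow> adj G y x"
    using sG by (auto simp: simple_graph_def)
  have cc: "col H u = c" "col H v = c" "col H w = c"
    and vs: "u \<in> verts H" "v \<in> verts H" "w \<in> verts H"
    using mem by (auto simp: color_class_def)
  have ne: "u \<noteq> v" "u \<noteq> w" "v \<noteq> w"
    using sH adj by (auto simp: simple_graph_def)
  obtain f where fu: "colored_embedding f H (verts H - {u}) G"
    and fv: "colored_embedding f H (verts H - {v}) G"
    and f: "f u = f v \<or> adj G (f u) (f v) \<noteq> adj H u v"
    using minimally_omitted_amalgam[OF sG uG H vs(1,2) ne(1)] by blast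
  have f_in: "f u \<in> verts G" "f v \<in> verts G" "f w \<in> verts G"
    "col G (f u) = c" "col G (f v) = c" "col G (f w) = c"
    using fu fv vs ne cc by (auto simp: colored_embedding_def)
  have a: "adj G (f u) (f w)" "adj G (f v) (f w)"
    using fu fv vs ne adj by (auto simp: colored_embedding_def)
  have eq: "f u = f v"
  proof (rule ccontr)
    assume "f u \<noteq> f v"
    then have "adj G (f u) (f v)"
      using CUH_adj_trans[OF G, of "f u" "f w" "f v"] f_in a(1) symG[OF a(2)] by simp
    then show False
      using f adj \<open>f u \<noteq> f v\<close> by blast
  qed
  \<comment> \<open>The left side is read off from the embedding of \<open>verts H - {v}\<close>,
    the right side from that of \<open>verts H - {u}\<close>; both concern the same vertex
    \<open>f u = f v\<close>.\<close>
  have "adj H u x \<longleftrightarrow> adj H v x" if "x \<in> verts H" "x \<noteq> u" "x \<noteq> v" for x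
  proof -
    have "adj H u x \<longleftrightarrow> adj G (f u) (f x)"
      using fv vs ne that by (auto simp: colored_embedding_def)
    also have "\<dots> \<longleftrightarrow> adj H v x"
      using fu vs ne that eq by (auto simp: colored_embedding_def)
    finally show ?thesis .
  qed
  moreover have "\<not> adj H u u" "\<not> adj H v v"
    using sH by (auto simp: simple_graph_def)
  ultimately have "neighborhood H u - {v} = neighborhood H v - {u}"
    unfolding neighborhood_def by blast
  then show ?thesis
    using vs cc by (simp add: twins_def)
qed

theorem theorem3p4:
  fixes G :: "'a colored_graph" and H :: "'b colored_graph"
  assumes "CUH_graph G"
    and "H \<in> minimally_omitted G"
    and "\<not> monochromatic H"
  shows "\<forall>c :: color.
    (\<exists>n\<ge>3. isomorphic_graphs (color_subgraph H c) (complete_graph n) \<and>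
       (\<forall>v \<in> verts (color_subgraph H c). \<forall>v' \<in> verts (color_subgraph H c).
          v \<noteq> v' \<longrightarrow> twins H v v')) \<or>
    isomorphic_graphs (color_subgraph H c) (complete_graph 2) \<or>
    (\<exists>n\<ge>1. isomorphic_graphs (color_subgraph H c) (edgeless_graph n))"
proof
  fix c
  let ?K = "color_subgraph H c" and ?C = "color_class H c"
  let ?n = "card ?C"
  have sH: "simple_graph H" and "finite (verts H)"
    using assms(2) by (auto simp: minimally_omitted_def)
  then have fin: "finite ?C"
    by (simp add: color_class_def)
  have vK: "verts ?K = ?C"
    and aK: "\<And>x y. x \<in> ?C \<Longrightarrow> y \<in> ?C \<Longrightarrow> adj ?K x y \<longleftrightarrow> adj H x y"
    by (auto simp: color_subgraph_def)
  have pos: "?n \<ge> 1"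
    using fin not_monochromatic_color_classes(1)[OF assms(3), of c]
    by (simp add: Suc_leI card_gt_0_iff)
  show "(\<exists>n\<ge>3. isomorphic_graphs ?K (complete_graph n) \<and>
       (\<forall>v \<in> verts ?K. \<forall>v' \<in> verts ?K. v \<noteq> v' \<longrightarrow> twins H v v')) \<or>
    isomorphic_graphs ?K (complete_graph 2) \<or>
    (\<exists>n\<ge>1. isomorphic_graphs ?K (edgeless_graph n))"
  proof (cases "\<exists>u\<in>?C. \<exists>w\<in>?C. adj H u w")
    case False
    then have "isomorphic_graphs ?K (edgeless_graph ?n)"
      using isomorphic_edgeless_graphI[of ?K] fin vK aK by auto
    then show ?thesis
      using pos by blast
  next
    case True
    then obtain u w where uw: "u \<in> ?C" "w \<in> ?C" "adj H u w"
      by blast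
    have sym: "\<And>x y. adj H x y \<Longrightarrow> adj H y x" and irr: "\<And>x. \<not> adj H x x"
      using sH by (auto simp: simple_graph_def)
    note step = minimally_omitted_color_class_adj[OF assms, where c = c]
    \<comment> \<open>The edge from \<open>u\<close> to \<open>w\<close> joins \<open>u\<close> to
      the whole class. Every other \<open>x\<close> then has the neighbor \<open>u\<close>, and so
      is joined to the whole class as well.\<close>
    have adj: "adj H x y" if "x \<in> ?C" "y \<in> ?C" "x \<noteq> y" for x y
    proof (cases "x = u")
      case True
      then show ?thesis using step[of u y w] uw that by blast
    next
      case False
      then have "adj H x u"
        using step[of u x w] uw that sym by blast
      then show ?thesis
        using step[of x y u] uw that by blast
    qed
    have "adj ?K x y \<longleftrightarrow> x \<noteq> y" if "x \<in> ?C" "y \<in> ?C" for x y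
      using that aK adj irr by metis
    then have iso: "isomorphic_graphs ?K (complete_graph ?n)"
      using isomorphic_complete_graphI[of ?K] fin vK by simp
    have "card {u, w} \<le> ?n"
      using uw fin by (intro card_mono) auto
    then have "?n \<ge> 2"
      using uw irr by (cases "u = w") auto
    then consider "?n = 2" | "?n \<ge> 3"
      by linarith
    then show ?thesis
    proof cases
      case 1
      then show ?thesis using iso by simp
    next
      case 2
      have "twins H x y" if xy: "x \<in> ?C" "y \<in> ?C" "x \<noteq> y" for x y
      proof -
        \<comment> \<open>With at least three vertices there is a third one, which completes a
          triangle on \<open>x\<close> and \<open>y\<close>.\<close>
        have "\<not> ?C \<subseteq> {x, y}"
          using card_mono[of "{x, y}" ?C] xy 2 by auto
        then obtain z where "z \<in> ?C" "z \<noteq> x" "z \<noteq> y"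
          by blast
        then show ?thesis
          using minimally_omitted_triangle_twins[OF assms(1,2), of x c y z] adj xy by metis
      qed
      then show ?thesis
        using iso 2 vK by blast
    qed
  qed
qed

end
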